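(* Let $\mathcal I$ be an ideal on a set $X$. Then: (i) non-empty subsets $Y,Z$ of $X$ are close in $\exp(X_{\mathcal I\text{-}ary})$ if and only if $Y\triangle Z\in\mathcal I$; (ii) two functions $f,g\in\{0,1\}^X$ are close in $\mathbb C(X,\mathcal I)$ if and only if $\operatorname{supp} f\,\triangle\,\operatorname{supp} g\in\mathcal I$; (iii) for every $A\subseteq X$, the connected components satisfy $\mathcal Q_{\exp(X_{\mathcal I})}(A)=\mathcal Q_{\exp(X_{\mathcal I\text{-}ary})}(A)$, and in particular $$\operatorname{dsc}(\exp(X_{\mathcal I}))=\operatorname{dsc}(\exp(X_{\mathcal I\text{-}ary}))\quad\text{and}\quad \operatorname{dsc}(\exp^\ast(X_{\mathcal I}))=\operatorname{dsc}(\exp^\ast(X_{\mathcal I\text{-}ary}))=\operatorname{dsc}(\mathbb C(X,\mathcal I));$$ (iv) $\operatorname{dsc}(\exp(X_{\mathcal I}))=\operatorname{dsc}(\mathbb C(X,\mathcal I))+1$.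
   Context: A ballean is a triple $\mathcal B=(X,P,B)$ where $X$ (the support) and $P\neq\emptyset$ (the radii set) are sets and $B\colon X\times P\to\mathcal P(X)$ is a map such that: $x\in B(x,\alpha)$ for all $x,\alpha$; $x\in B(y,\alpha)$ iff $y\in B(x,\alpha)$; for all $\alpha,\beta\in P$ there is $\gamma\in P$ with $B(B(x,\alpha),\beta)\subseteq B(x,\gamma)$ for all $x\in X$, where $B(A,\delta)=\bigcup_{y\in A}B(y,\delta)$. The subballean on $Y\subseteq X$ is $(Y,P,B_Y)$ with $B_Y(y,\alpha)=B(y,\alpha)\cap Y$. The connected component of $x\in X$ is $\mathcal Q_X(x)=\bigcup_{\alpha\in P}B(x,\alpha)$; the connected components partition $X$, and $\operatorname{dsc}(\mathcal B)$ denotes the (cardinal) number of connected components. "Close in" a ballean means lying in the same connected component of that ballean. The hyperballean of $\mathcal B=(X,P,B)$ is $\exp(\mathcal B)=(\mathcal P(X),P,\exp B)$, with $\exp B(A,\alpha)=\{C\in\mathcal P(X)\mid A\subseteq B(C,\alpha),\ C\subseteq B(A,\alpha)\}$; $\exp^\ast(\mathcal B)$ is its subballean on $\mathcal P(X)\setminus\{\emptyset\}$. An ideal $\mathcal I$ on $X$ is a family of subsets of $X$ closed under finite unions and subsets; it is always assumed that $X\notin\mathcal I$ and that $\mathcal I$ contains all finite subsets of $X$. The $\mathcal I$-ary ballean $X_{\mathcal I\text{-}ary}=(X,\mathcal I,B_{\mathcal I\text{-}ary})$ has balls $B_{\mathcal I\text{-}ary}(x,A)=\{x\}\cup A$. The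 point ideal ballean $X_{\mathcal I}=(X,\mathcal I,B_{\mathcal I})$ has balls $B_{\mathcal I}(x,A)=\{x\}$ if $x\notin A$ and $B_{\mathcal I}(x,A)=A$ if $x\in A$. The ballean $\mathbb C(X,\mathcal I)$ has support $\{0,1\}^X$, radii set $\mathcal I$ and balls $B_{\mathbb C}(f,A)=\{g\in\{0,1\}^X\mid g\restriction_{X\setminus A}=f\restriction_{X\setminus A}\}$. For $f\in\{0,1\}^X$, $\operatorname{supp} f=\{x\in X\mid f(x)=1\}$. $\triangle$ is symmetric difference. *)

theory Defs
  imports Main "HOL-Library.FuncSet"
begin

unbundle cardinal_syntax

record ('a, 'r) ballean =
  support :: "'a set"
  radii :: "'r set"
  ball :: "'a \<Rightarrow> 'r \<Rightarrow> 'a set"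

definition ball_set :: "('a, 'r) ballean \<Rightarrow> 'a set \<Rightarrow> 'r \<Rightarrow> 'a set" where
  "ball_set \<B> A \<delta> = (\<Union>y\<in>A. ball \<B> y \<delta>)"

text \<open>The record only carries the data; the axioms are collected in the following predicate.
  The values of \<^const>\<open>ball\<close> outside the support and the radii set are irrelevant.\<close>

definition is_ballean :: "('a, 'r) ballean \<Rightarrow> bool" where
  "is_ballean \<B> \<longleftrightarrow>
     radii \<B> \<noteq> {} \<and>
     (\<forall>x\<in>support \<B>. \<forall>\<alpha>\<in>radii \<B>. ball \<B> x \<alpha> \<subseteq> support \<B>) \<and>
     (\<forall>x\<in>support \<B>. \<forall>\<alpha>\<in>radii \<B>. x \<in> ball \<B> x \<alpha>) \<and>
     (\<forall>x\<in>support \<B>. \<forall>y\<in>support \<B>. \<forall>\<alpha>\<in>radii \<B>.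
        x \<in> ball \<B> y \<alpha> \<longleftrightarrow> y \<in> ball \<B> x \<alpha>) \<and>
     (\<forall>\<alpha>\<in>radii \<B>. \<forall>\<beta>\<in>radii \<B>. \<exists>\<gamma>\<in>radii \<B>. \<forall>x\<in>support \<B>.
        ball_set \<B> (ball \<B> x \<alpha>) \<beta> \<subseteq> ball \<B> x \<gamma>)"

definition subballean :: "('a, 'r) ballean \<Rightarrow> 'a set \<Rightarrow> ('a, 'r) ballean" where
  "subballean \<B> Y =
     \<lparr>support = Y, radii = radii \<B>, ball = (\<lambda>y \<alpha>. ball \<B> y \<alpha> \<inter> Y)\<rparr>"

definition component :: "('a, 'r) ballean \<Rightarrow> 'a \<Rightarrow> 'a set" where
  "component \<B> x = (\<Union>\<alpha>\<in>radii \<B>. ball \<B> x \<alpha>)"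

definition components :: "('a, 'r) ballean \<Rightarrow> 'a set set" where
  "components \<B> = component \<B> ` support \<B>"

text \<open>A cardinal in the sense of \<^const>\<open>card_of\<close>, that is, a well-order; equality of cardinals
  is to be read as \<^const>\<open>ordIso2\<close>.\<close>

definition dsc :: "('a, 'r) ballean \<Rightarrow> 'a set rel" where
  "dsc \<B> = card_of (components \<B>)"

definition close_in :: "('a, 'r) ballean \<Rightarrow> 'a \<Rightarrow> 'a \<Rightarrow> bool" where
  "close_in \<B> x y \<longleftrightarrow> (\<exists>Q\<in>components \<B>. x \<in> Q \<and> y \<in> Q)"

definition hyperballean :: "('a, 'r) ballean \<Rightarrow> ('a set, 'r) ballean" where
  "hyperballean \<B> =
     \<lparr>support = Pow (support \<B>), radii = radii \<B>,
      ball = (\<lambda>A \<alpha>. {C \<in> Pow (support \<B>). A \<subseteq> ball_set \<B> C \<alpha> \<and> C \<subseteq> ball_set \<B> A \<alpha>})\<rparr>"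

definition hyperballean_star :: "('a, 'r) ballean \<Rightarrow> ('a set, 'r) ballean" where
  "hyperballean_star \<B> = subballean (hyperballean \<B>) (Pow (support \<B>) - {{}})"

text \<open>The standing assumptions that \<open>X \<notin> \<I>\<close> and that \<open>\<I>\<close> contains the finite subsets of \<open>X\<close>
  are part of the definition.\<close>

definition ideal_on :: "'a set \<Rightarrow> 'a set set \<Rightarrow> bool" where
  "ideal_on X \<I> \<longleftrightarrow>
     \<I> \<subseteq> Pow X \<and>
     (\<forall>A\<in>\<I>. \<forall>B\<in>\<I>. A \<union> B \<in> \<I>) \<and>
     (\<forall>A\<in>\<I>. \<forall>B. B \<subseteq> A \<longrightarrow> B \<in> \<I>) \<and>
     X \<notin> \<I> \<and>
     (\<forall>F. F \<subseteq> X \<and> finite F \<longrightarrow> F \<in> \<I>)"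

definition ary_ballean :: "'a set \<Rightarrow> 'a set set \<Rightarrow> ('a, 'a set) ballean" where
  "ary_ballean X \<I> = \<lparr>support = X, radii = \<I>, ball = (\<lambda>x A. {x} \<union> A)\<rparr>"

definition point_ideal_ballean :: "'a set \<Rightarrow> 'a set set \<Rightarrow> ('a, 'a set) ballean" where
  "point_ideal_ballean X \<I> =
     \<lparr>support = X, radii = \<I>, ball = (\<lambda>x A. if x \<in> A then A else {x})\<rparr>"

text \<open>Functions on \<open>X\<close> are represented by extensional functions, so that they are determined by
  their values on \<open>X\<close>.\<close>

definition two_functions :: "'a set \<Rightarrow> ('a \<Rightarrow> nat) set" where
  "two_functions X = X \<rightarrow>\<^sub>E {0, 1}"

definition supp :: "'a set \<Rightarrow> ('a \<Rightarrow> nat) \<Rightarrow> 'a set" where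
  "supp X f = {x \<in> X. f x = 1}"

definition C_ballean :: "'a set \<Rightarrow> 'a set set \<Rightarrow> ('a \<Rightarrow> nat, 'a set) ballean" where
  "C_ballean X \<I> =
     \<lparr>support = two_functions X, radii = \<I>,
      ball = (\<lambda>f A. {g \<in> two_functions X. restrict g (X - A) = restrict f (X - A)})\<rparr>"

lemma is_balleanI:
  assumes "radii \<B> \<noteq> {}"
    and "\<And>x \<alpha>. x \<in> support \<B> \<Longrightarrow> \<alpha> \<in> radii \<B> \<Longrightarrow> ball \<B> x \<alpha> \<subseteq> support \<B>"
    and "\<And>x \<alpha>. x \<in> support \<B> \<Longrightarrow> \<alpha> \<in> radii \<B> \<Longrightarrow> x \<in> ball \<B> x \<alpha>"
    and "\<And>x y \<alpha>. x \<in> support \<B> \<Longrightarrow> y \<in> support \<B> \<Longrightarrow> \<alpha> \<in> radii \<B> \<Longrightarrow>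
      x \<in> ball \<B> y \<alpha> \<Longrightarrow> y \<in> ball \<B> x \<alpha>"
    and "\<And>\<alpha> \<beta>. \<alpha> \<in> radii \<B> \<Longrightarrow> \<beta> \<in> radii \<B> \<Longrightarrow> \<exists>\<gamma>\<in>radii \<B>. \<forall>x\<in>support \<B>.
      \<forall>y\<in>ball \<B> x \<alpha>. ball \<B> y \<beta> \<subseteq> ball \<B> x \<gamma>"
  shows "is_ballean \<B>"
  unfolding is_ballean_def ball_set_def UN_subset_iff
  by (intro conjI ballI iffI) (use assms in simp_all)

lemma is_balleanD:
  assumes "is_ballean \<B>"
  shows "radii \<B> \<noteq> {}"
    and "x \<in> support \<B> \<Longrightarrow> \<alpha> \<in> radii \<B> \<Longrightarrow> ball \<B> x \<alpha> \<subseteq> support \<B>"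
    and "x \<in> support \<B> \<Longrightarrow> \<alpha> \<in> radii \<B> \<Longrightarrow> x \<in> ball \<B> x \<alpha>"
    and "x \<in> support \<B> \<Longrightarrow> y \<in> support \<B> \<Longrightarrow> \<alpha> \<in> radii \<B> \<Longrightarrow>
      x \<in> ball \<B> y \<alpha> \<longleftrightarrow> y \<in> ball \<B> x \<alpha>"
    and "\<alpha> \<in> radii \<B> \<Longrightarrow> \<beta> \<in> radii \<B> \<Longrightarrow> \<exists>\<gamma>\<in>radii \<B>. \<forall>x\<in>support \<B>.
      \<forall>y\<in>ball \<B> x \<alpha>. ball \<B> y \<beta> \<subseteq> ball \<B> x \<gamma>"
  using assms unfolding is_ballean_def ball_set_def UN_subset_iff by simp_all

lemma is_ballean_subballean:
  assumes B: "is_ballean \<B>" and Y: "Y \<subseteq> support \<B>"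
  shows "is_ballean (subballean \<B> Y)"
proof (rule is_balleanI, unfold subballean_def ballean.simps)
  fix \<alpha> \<beta> assume "\<alpha> \<in> radii \<B>" "\<beta> \<in> radii \<B>"
  then obtain \<gamma> where "\<gamma> \<in> radii \<B>"
    and "\<forall>x\<in>support \<B>. \<forall>y\<in>ball \<B> x \<alpha>. ball \<B> y \<beta> \<subseteq> ball \<B> x \<gamma>"
    using is_balleanD(5)[OF B] by blast
  then show "\<exists>\<gamma>\<in>radii \<B>. \<forall>x\<in>Y. \<forall>y\<in>ball \<B> x \<alpha> \<inter> Y.
      ball \<B> y \<beta> \<inter> Y \<subseteq> ball \<B> x \<gamma> \<inter> Y"
    using Y by (intro bexI[of _ \<gamma>]) blast+
qed (use is_balleanD(1,3)[OF B] is_balleanD(4)[OF B] Y in \<open>auto simp: subset_iff\<close>)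

lemma is_ballean_hyperballean:
  assumes B: "is_ballean \<B>"
  shows "is_ballean (hyperballean \<B>)"
proof (rule is_balleanI, unfold hyperballean_def ballean.simps)
  show "A \<in> {C \<in> Pow (support \<B>). A \<subseteq> ball_set \<B> C \<alpha> \<and> C \<subseteq> ball_set \<B> A \<alpha>}"
    if "A \<in> Pow (support \<B>)" "\<alpha> \<in> radii \<B>" for A \<alpha>
    using that is_balleanD(3)[OF B] by (auto simp: ball_set_def)
next
  fix \<alpha> \<beta> assume ab: "\<alpha> \<in> radii \<B>" "\<beta> \<in> radii \<B>"
  obtain \<gamma> where g: "\<gamma> \<in> radii \<B>"
    "\<forall>x\<in>support \<B>. \<forall>y\<in>ball \<B> x \<alpha>. ball \<B> y \<beta> \<subseteq> ball \<B> x \<gamma>"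
    using is_balleanD(5)[OF B] ab by blast
  have up: "C \<subseteq> ball_set \<B> A \<gamma>"
    if S: "A \<subseteq> support \<B>" "D \<subseteq> ball_set \<B> A \<alpha>" "C \<subseteq> ball_set \<B> D \<beta>" for A C D
  proof
    fix c assume "c \<in> C"
    then obtain d where "d \<in> D" "c \<in> ball \<B> d \<beta>" using S(3) by (auto simp: ball_set_def)
    moreover then obtain a where "a \<in> A" "d \<in> ball \<B> a \<alpha>"
      using S(2) by (auto simp: ball_set_def)
    ultimately show "c \<in> ball_set \<B> A \<gamma>"
      using g(2) S(1) by (auto simp: ball_set_def)
  qed
  have down: "A \<subseteq> ball_set \<B> C \<gamma>"
    if S: "A \<subseteq> support \<B>" "D \<subseteq> support \<B>" "C \<subseteq> support \<B>"
      "A \<subseteq> ball_set \<B> D \<alpha>" "D \<subseteq> ball_set \<B> C \<beta>" for A C D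
  proof
    fix a assume a: "a \<in> A"
    then obtain d where d: "d \<in> D" "a \<in> ball \<B> d \<alpha>" using S(4) by (auto simp: ball_set_def)
    then obtain c where c: "c \<in> C" "d \<in> ball \<B> c \<beta>" using S(5) by (auto simp: ball_set_def)
    have s: "a \<in> support \<B>" "d \<in> support \<B>" "c \<in> support \<B>" using a c d S by auto
    have "d \<in> ball \<B> a \<alpha>" "c \<in> ball \<B> d \<beta>"
      using c d s ab is_balleanD(4)[OF B] by simp_all
    then have "c \<in> ball \<B> a \<gamma>" using g(2) s by blast
    then have "a \<in> ball \<B> c \<gamma>" using s g(1) is_balleanD(4)[OF B] by simp
    then show "a \<in> ball_set \<B> C \<gamma>" using c by (auto simp: ball_set_def)
  qed
  show "\<exists>\<gamma>\<in>radii \<B>. \<forall>A\<in>Pow (support \<B>).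
      \<forall>D\<in>{C \<in> Pow (support \<B>). A \<subseteq> ball_set \<B> C \<alpha> \<and> C \<subseteq> ball_set \<B> A \<alpha>}.
        {C \<in> Pow (support \<B>). D \<subseteq> ball_set \<B> C \<beta> \<and> C \<subseteq> ball_set \<B> D \<beta>}
        \<subseteq> {C \<in> Pow (support \<B>). A \<subseteq> ball_set \<B> C \<gamma> \<and> C \<subseteq> ball_set \<B> A \<gamma>}"
    by (rule bexI[OF _ g(1)], intro ballI subsetI CollectI, elim CollectE conjE)
      (intro conjI; (assumption | rule up down; (assumption | erule PowD)))
qed (use is_balleanD(1)[OF B] in auto)

lemma is_ballean_hyperballean_star:
  "is_ballean \<B> \<Longrightarrow> is_ballean (hyperballean_star \<B>)"
  unfolding hyperballean_star_def
  by (rule is_ballean_subballean[OF is_ballean_hyperballean]) (auto simp: hyperballean_def)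

lemma is_ballean_point_ideal_ballean:
  assumes "ideal_on X \<I>"
  shows "is_ballean (point_ideal_ballean X \<I>)"
proof (rule is_balleanI, unfold point_ideal_ballean_def ballean.simps)
  fix \<alpha> \<beta> assume "\<alpha> \<in> \<I>" "\<beta> \<in> \<I>"
  then have "\<alpha> \<union> \<beta> \<in> \<I>" using assms by (simp add: ideal_on_def)
  then show "\<exists>\<gamma>\<in>\<I>. \<forall>x\<in>X. \<forall>y\<in>if x \<in> \<alpha> then \<alpha> else {x}.
      (if y \<in> \<beta> then \<beta> else {y}) \<subseteq> (if x \<in> \<gamma> then \<gamma> else {x})"
    by (rule rev_bexI) auto
qed (use assms in \<open>auto simp: ideal_on_def split: if_splits\<close>)

lemma is_ballean_C_ballean:
  assumes "ideal_on X \<I>"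
  shows "is_ballean (C_ballean X \<I>)"
proof -
  have r: "restrict g (X - A) = restrict f (X - A) \<longleftrightarrow> (\<forall>x\<in>X - A. g x = f x)"
    for f g :: "'a \<Rightarrow> nat" and A
    by (auto simp: fun_eq_iff)
  show ?thesis
  proof (rule is_balleanI, unfold C_ballean_def ballean.simps r)
    fix \<alpha> \<beta> assume "\<alpha> \<in> \<I>" "\<beta> \<in> \<I>"
    then have "\<alpha> \<union> \<beta> \<in> \<I>" using assms by (simp add: ideal_on_def)
    then show "\<exists>\<gamma>\<in>\<I>. \<forall>f\<in>two_functions X.
        \<forall>g\<in>{g \<in> two_functions X. \<forall>x\<in>X - \<alpha>. g x = f x}.
          {h \<in> two_functions X. \<forall>x\<in>X - \<beta>. h x = g x}
          \<subseteq> {h \<in> two_functions X. \<forall>x\<in>X - \<gamma>. h x = f x}"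
      by (rule rev_bexI) auto
  next
    show "\<I> \<noteq> {}" using assms by (auto simp: ideal_on_def)
  qed simp_all
qed

text \<open>Pitfall: taken literally, the balls \<open>{x} \<union> A\<close> violate the symmetry axiom, so
  \<^const>\<open>ary_ballean\<close> does not satisfy \<^const>\<open>is_ballean\<close>. Its hyperballean, however,
  does, so the connected components of the latter form a partition.\<close>

lemma not_is_ballean_ary_ballean:
  assumes "ideal_on X \<I>"
  shows "\<not> is_ballean (ary_ballean X \<I>)"
proof
  assume B: "is_ballean (ary_ballean X \<I>)"
  have "infinite X" using assms by (auto simp: ideal_on_def)
  then obtain x where x: "x \<in> X" by fastforce
  obtain y where y: "y \<in> X" "y \<noteq> x"
    using \<open>infinite X\<close> by (metis finite.emptyI finite_insert finite_subset insertI1 subsetI singletonD)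
  have "{x} \<in> \<I>" using assms x by (simp add: ideal_on_def)
  then show False
    using is_balleanD(4)[OF B, of x y "{x}"] x y by (simp add: ary_ballean_def)
qed

lemma is_ballean_hyperballean_ary_ballean:
  assumes "ideal_on X \<I>"
  shows "is_ballean (hyperballean (ary_ballean X \<I>))"
proof -
  have b: "ball_set (ary_ballean X \<I>) A \<alpha> = (if A = {} then {} else A \<union> \<alpha>)" for A \<alpha>
    by (auto simp: ball_set_def ary_ballean_def)
  have e: "hyperballean (ary_ballean X \<I>) = \<lparr>support = Pow X, radii = \<I>,
      ball = (\<lambda>A \<alpha>. {C. C \<subseteq> X \<and> (A = {} \<longleftrightarrow> C = {}) \<and> A \<subseteq> C \<union> \<alpha> \<and> C \<subseteq> A \<union> \<alpha>})\<rparr>"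
    unfolding hyperballean_def b by (auto simp: ary_ballean_def fun_eq_iff)
  show ?thesis
  proof (rule is_balleanI, unfold e ballean.simps)
    fix \<alpha> \<beta> assume "\<alpha> \<in> \<I>" "\<beta> \<in> \<I>"
    then have "\<alpha> \<union> \<beta> \<in> \<I>" using assms by (simp add: ideal_on_def)
    then show "\<exists>\<gamma>\<in>\<I>. \<forall>A\<in>Pow X.
        \<forall>D\<in>{C. C \<subseteq> X \<and> (A = {} \<longleftrightarrow> C = {}) \<and> A \<subseteq> C \<union> \<alpha> \<and> C \<subseteq> A \<union> \<alpha>}.
          {C. C \<subseteq> X \<and> (D = {} \<longleftrightarrow> C = {}) \<and> D \<subseteq> C \<union> \<beta> \<and> C \<subseteq> D \<union> \<beta>}
          \<subseteq> {C. C \<subseteq> X \<and> (A = {} \<longleftrightarrow> C = {}) \<and> A \<subseteq> C \<union> \<gamma> \<and> C \<subseteq> A \<union> \<gamma>}"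
      by (rule rev_bexI) (intro ballI subsetI CollectI; elim CollectE conjE; intro conjI; blast)
  next
    show "\<I> \<noteq> {}" using assms by (auto simp: ideal_on_def)
  qed auto
qed

end

theory Submission
  imports Defs
begin

text \<open>For non-empty \<open>Y, Z \<subseteq> X\<close> with \<open>Y \<triangle> Z \<in> \<I>\<close>, a radius containing \<open>Y \<triangle> Z\<close>, a point of \<open>Y\<close>
  and a point of \<open>Z\<close> witnesses that \<open>Y\<close> and \<open>Z\<close> are close in both hyperballeans, while the empty
  set is a component of its own. Up to that singleton, the components are therefore the classes of
  \<open>Pow X\<close> modulo \<open>\<I>\<close>, as they are for \<open>C_ballean X \<I>\<close>: every class modulo \<open>\<I>\<close> has a
  non-empty member because \<open>\<I>\<close> contains the singletons.\<close>

section \<open>Ideals, components of an arbitrary ballean, and cardinals of images\<close>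

lemma ideal_onD:
  assumes "ideal_on X \<I>"
  shows "A \<in> \<I> \<Longrightarrow> B \<in> \<I> \<Longrightarrow> A \<union> B \<in> \<I>"
    and "A \<in> \<I> \<Longrightarrow> B \<subseteq> A \<Longrightarrow> B \<in> \<I>"
    and "F \<subseteq> X \<Longrightarrow> finite F \<Longrightarrow> F \<in> \<I>"
    and "X \<noteq> {}"
  using assms by (auto simp: ideal_on_def)

text \<open>Lying in the component of a point is an equivalence relation on the support: symmetry of
  balls gives symmetry, the composition axiom gives transitivity. Comparing components thus reduces
  to one membership test.\<close>

lemma component_eq_iff:
  assumes B: "is_ballean \<B>" and x: "x \<in> support \<B>" and y: "y \<in> support \<B>"
  shows "component \<B> x = component \<B> y \<longleftrightarrow> y \<in> component \<B> x"
proof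
  assume "component \<B> x = component \<B> y"
  then show "y \<in> component \<B> x"
    using is_balleanD(1,3)[OF B] y by (auto simp: component_def)
next
  have trans: "component \<B> v \<subseteq> component \<B> u"
    if v: "v \<in> component \<B> u" and u: "u \<in> support \<B>" for u v
  proof
    fix w assume "w \<in> component \<B> v"
    then obtain \<alpha> \<beta> where ab: "\<alpha> \<in> radii \<B>" "\<beta> \<in> radii \<B>"
      "v \<in> ball \<B> u \<alpha>" "w \<in> ball \<B> v \<beta>"
      using v by (auto simp: component_def)
    obtain \<gamma> where g: "\<gamma> \<in> radii \<B>"
      "\<forall>x\<in>support \<B>. \<forall>y\<in>ball \<B> x \<alpha>. ball \<B> y \<beta> \<subseteq> ball \<B> x \<gamma>"
      using is_balleanD(5)[OF B ab(1,2)] by blast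
    have "w \<in> ball \<B> u \<gamma>"
      by (rule subsetD[OF bspec[OF bspec[OF g(2) u] ab(3)] ab(4)])
    then show "w \<in> component \<B> u"
      using g(1) by (auto simp: component_def)
  qed
  assume "y \<in> component \<B> x"
  moreover from this have "x \<in> component \<B> y"
    using is_balleanD(4)[OF B] x y by (auto simp: component_def)
  ultimately show "component \<B> x = component \<B> y"
    using trans x y by (intro equalityI)
qed

lemma close_in_iff:
  assumes B: "is_ballean \<B>" and x: "x \<in> support \<B>" and y: "y \<in> support \<B>"
  shows "close_in \<B> x y \<longleftrightarrow> y \<in> component \<B> x"
proof
  assume "close_in \<B> x y"
  then obtain z where "z \<in> support \<B>" "x \<in> component \<B> z" "y \<in> component \<B> z"
    by (auto simp: close_in_def components_def)
  then show "y \<in> component \<B> x"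
    using component_eq_iff[OF B] x by blast
next
  assume "y \<in> component \<B> x"
  moreover have "x \<in> component \<B> x"
    using component_eq_iff[OF B x x] by simp
  ultimately show "close_in \<B> x y"
    using x by (auto simp: close_in_def components_def)
qed

text \<open>With \<open>f\<close> and \<open>g\<close> read as quotient maps, \<open>h\<close>
  induces a map of quotients: \<open>iff\<close> makes it well defined and injective,
  \<open>onto\<close> surjective. Only classes have to be hit, so \<open>h\<close> may miss elements
  of \<open>T\<close>.\<close>

lemma card_of_image_ordIso_image:
  assumes h: "h ` S \<subseteq> T"
    and iff: "\<And>x y. x \<in> S \<Longrightarrow> y \<in> S \<Longrightarrow> f x = f y \<longleftrightarrow> g (h x) = g (h y)"
    and onto: "\<And>t. t \<in> T \<Longrightarrow> \<exists>x\<in>S. g (h x) = g t"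
  shows "|f ` S| =o |g ` T|"
proof (rule card_of_ordIsoI)
  \<comment> \<open>\<open>inv_into\<close> picks a representative of the class \<open>Q\<close>;
    the next fact shows that the choice does not matter.\<close>
  let ?k = "\<lambda>Q. g (h (inv_into S f Q))"
  have k: "?k (f x) = g (h x)" if "x \<in> S" for x
    using that iff[of "inv_into S f (f x)" x] by (simp add: inv_into_into f_inv_into_f)
  show "bij_betw ?k (f ` S) (g ` T)"
  proof (rule bij_betw_imageI)
    show "inj_on ?k (f ` S)"
      by (rule inj_onI) (auto simp: k iff)
    have "?k ` f ` S = (\<lambda>x. g (h x)) ` S"
      unfolding image_image by (rule image_cong) (simp_all add: k)
    also have "\<dots> = g ` T"
    proof
      show "(\<lambda>x. g (h x)) ` S \<subseteq> g ` T" using h by auto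
      show "g ` T \<subseteq> (\<lambda>x. g (h x)) ` S"
      proof (rule image_subsetI)
        fix t assume "t \<in> T"
        then obtain x where "x \<in> S" "g (h x) = g t" using onto by blast
        then show "g t \<in> (\<lambda>x. g (h x)) ` S" by (intro image_eqI[of _ _ x]) auto
      qed
    qed
    finally show "?k ` f ` S = g ` T" .
  qed
qed

lemma card_of_insert_csum_cone:
  assumes "x \<notin> A"
  shows "|insert x A| =o |A| +c cone"
proof -
  \<comment> \<open>\<open>cone\<close> is the cardinal of \<open>{()}\<close>, so the new element
    \<open>x\<close> goes to \<open>Inr ()\<close>.\<close>
  have "bij_betw (\<lambda>y. if y = x then Inr () else Inl y) (insert x A) (A <+> {()})"
    using assms by (auto simp: bij_betw_def inj_on_def image_iff Plus_def)
  then show ?thesis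
    unfolding csum_def cone_def Field_card_of by (rule card_of_ordIsoI)
qed

section \<open>Components of the two hyperballeans\<close>

lemma mem_component_hyperballean_ary:
  assumes I: "ideal_on X \<I>" and A: "A \<subseteq> X"
  shows "C \<in> component (hyperballean (ary_ballean X \<I>)) A \<longleftrightarrow>
    C \<subseteq> X \<and> (A = {} \<longleftrightarrow> C = {}) \<and> sym_diff A C \<in> \<I>"
proof -
  \<comment> \<open>No centre, no ball: the case \<open>D = {}\<close> is what separates the empty
    set from all others.\<close>
  have b: "ball_set (ary_ballean X \<I>) D \<alpha> = (if D = {} then {} else D \<union> \<alpha>)" for D \<alpha>
    by (auto simp: ball_set_def ary_ballean_def)
  have "C \<in> component (hyperballean (ary_ballean X \<I>)) A \<longleftrightarrow>
      C \<subseteq> X \<and> (A = {} \<longleftrightarrow> C = {}) \<and> (\<exists>\<alpha>\<in>\<I>. sym_diff A C \<subseteq> \<alpha>)"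
    unfolding component_def hyperballean_def b using ideal_onD(3)[OF I, of "{}"]
    by (auto simp: ary_ballean_def)
  also have "(\<exists>\<alpha>\<in>\<I>. sym_diff A C \<subseteq> \<alpha>) \<longleftrightarrow> sym_diff A C \<in> \<I>"
    using ideal_onD(2)[OF I] by blast
  finally show ?thesis .
qed

lemma mem_component_hyperballean_point_ideal:
  assumes I: "ideal_on X \<I>" and A: "A \<subseteq> X"
  shows "C \<in> component (hyperballean (point_ideal_ballean X \<I>)) A \<longleftrightarrow>
    C \<subseteq> X \<and> (A = {} \<longleftrightarrow> C = {}) \<and> sym_diff A C \<in> \<I>"
proof -
  \<comment> \<open>Only a centre inside \<alpha> has a ball larger than itself or equal to
    \<alpha>, so \<alpha> is added exactly when \<open>D\<close> meets it.\<close>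
  have b: "ball_set (point_ideal_ballean X \<I>) D \<alpha> = (if D \<inter> \<alpha> = {} then D else D \<union> \<alpha>)" for D \<alpha>
    by (auto simp: ball_set_def point_ideal_ballean_def)
  have mem: "C \<in> component (hyperballean (point_ideal_ballean X \<I>)) A \<longleftrightarrow>
      C \<subseteq> X \<and> (\<exists>\<alpha>\<in>\<I>. A \<subseteq> (if C \<inter> \<alpha> = {} then C else C \<union> \<alpha>) \<and>
        C \<subseteq> (if A \<inter> \<alpha> = {} then A else A \<union> \<alpha>))"
    unfolding component_def hyperballean_def b by (auto simp: point_ideal_ballean_def)
  show ?thesis
  proof
    assume "C \<in> component (hyperballean (point_ideal_ballean X \<I>)) A"
    then obtain \<alpha> where C: "C \<subseteq> X" "\<alpha> \<in> \<I>"
      "A \<subseteq> (if C \<inter> \<alpha> = {} then C else C \<union> \<alpha>)" "C \<subseteq> (if A \<inter> \<alpha> = {} then A else A \<union> \<alpha>)"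
      unfolding mem by blast
    \<comment> \<open>An empty \<open>A\<close> misses \<alpha>, which forces
      \<open>C \<subseteq> A\<close>; the same holds with \<open>A\<close> and \<open>C\<close>
      exchanged.\<close>
    then have "sym_diff A C \<subseteq> \<alpha>" "A = {} \<longleftrightarrow> C = {}" by (auto split: if_splits)
    then show "C \<subseteq> X \<and> (A = {} \<longleftrightarrow> C = {}) \<and> sym_diff A C \<in> \<I>"
      using C ideal_onD(2)[OF I] by blast
  next
    assume C: "C \<subseteq> X \<and> (A = {} \<longleftrightarrow> C = {}) \<and> sym_diff A C \<in> \<I>"
    show "C \<in> component (hyperballean (point_ideal_ballean X \<I>)) A"
    proof (cases "A = {}")
      case True
      then show ?thesis using C unfolding mem by auto
    next
      case False
      then obtain a c where ac: "a \<in> A" "c \<in> C" using C by blast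
      \<comment> \<open>The radius \<open>sym_diff A C\<close> alone may miss one of the sets: it
        misses \<open>C\<close> when \<open>C \<subseteq> A\<close>. Adding \<open>a\<close> and
        \<open>c\<close> makes it meet both.\<close>
      have "{a, c} \<in> \<I>"
        by (rule ideal_onD(3)[OF I]) (use ac A C in auto)
      then have "sym_diff A C \<union> {a, c} \<in> \<I>"
        using C ideal_onD(1)[OF I] by blast
      then show ?thesis
        unfolding mem using C ac by (intro conjI bexI[of _ "sym_diff A C \<union> {a, c}"]) auto
    qed
  qed
qed

lemma component_hyperballean_point_ideal_eq_ary:
  assumes "ideal_on X \<I>" and "A \<subseteq> X"
  shows "component (hyperballean (point_ideal_ballean X \<I>)) A =
    component (hyperballean (ary_ballean X \<I>)) A"
  using assms
  by (intro set_eqI)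
    (simp add: mem_component_hyperballean_ary mem_component_hyperballean_point_ideal)

lemma components_hyperballean_point_ideal_eq_ary:
  assumes "ideal_on X \<I>"
  shows "components (hyperballean (point_ideal_ballean X \<I>)) =
    components (hyperballean (ary_ballean X \<I>))"
proof -
  have "support (hyperballean (point_ideal_ballean X \<I>)) = Pow X"
    "support (hyperballean (ary_ballean X \<I>)) = Pow X"
    by (simp_all add: hyperballean_def point_ideal_ballean_def ary_ballean_def)
  then show ?thesis
    unfolding components_def
    by (auto intro!: image_cong simp: component_hyperballean_point_ideal_eq_ary[OF assms])
qed

section \<open>Restriction to the non-empty subsets\<close>

lemma component_subballean: "component (subballean \<B> Y) x = component \<B> x \<inter> Y"
  by (auto simp: component_def subballean_def)

lemma components_hyperballean_star:
  "components (hyperballean_star \<B>) =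
    (\<lambda>A. component (hyperballean \<B>) A \<inter> (Pow (support \<B>) - {{}})) ` (Pow (support \<B>) - {{}})"
  by (simp add: components_def hyperballean_star_def component_subballean)
    (simp add: subballean_def)

lemma components_hyperballean_star_point_ideal_eq_ary:
  assumes "ideal_on X \<I>"
  shows "components (hyperballean_star (point_ideal_ballean X \<I>)) =
    components (hyperballean_star (ary_ballean X \<I>))"
proof -
  have "support (point_ideal_ballean X \<I>) = X" "support (ary_ballean X \<I>) = X"
    by (simp_all add: point_ideal_ballean_def ary_ballean_def)
  then show ?thesis
    unfolding components_hyperballean_star
    by (auto intro!: image_cong simp: component_hyperballean_point_ideal_eq_ary[OF assms])
qed

text \<open>The empty set is alone in its component, and the component of a non-empty set has only
  non-empty members, so restricting to \<open>Pow X - {{}}\<close> leaves it unchanged.\<close>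

lemma components_hyperballean_ary_eq_insert:
  assumes I: "ideal_on X \<I>"
  shows "components (hyperballean (ary_ballean X \<I>)) =
    insert {{}} (components (hyperballean_star (ary_ballean X \<I>)))"
proof -
  let ?H = "hyperballean (ary_ballean X \<I>)"
  have s: "support (ary_ballean X \<I>) = X" "support ?H = Pow X"
    by (simp_all add: ary_ballean_def hyperballean_def)
  have empty: "component ?H {} = {{}}"
    using ideal_onD(3)[OF I, of "{}"] by (auto simp: mem_component_hyperballean_ary[OF I])
  have "component ?H A \<inter> (Pow X - {{}}) = component ?H A" if "A \<in> Pow X - {{}}" for A
    using that by (auto simp: mem_component_hyperballean_ary[OF I])
  then have "components (hyperballean_star (ary_ballean X \<I>)) = component ?H ` (Pow X - {{}})"
    unfolding components_hyperballean_star s by (intro image_cong) auto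
  moreover have "components ?H = component ?H ` insert {} (Pow X - {{}})"
    unfolding components_def s by (rule arg_cong[where f = "image _"]) auto
  ultimately show ?thesis by (simp only: image_insert empty)
qed

section \<open>Components of \<open>C_ballean\<close> and their comparison with those of the
  hyperballean\<close>

lemma mem_component_C_ballean:
  assumes I: "ideal_on X \<I>" and f: "f \<in> two_functions X"
  shows "g \<in> component (C_ballean X \<I>) f \<longleftrightarrow>
    g \<in> two_functions X \<and> sym_diff (supp X f) (supp X g) \<in> \<I>"
proof -
  \<comment> \<open>Functions with values in \<open>{0, 1}\<close> differ at a point exactly when it
    lies in one support only.\<close>
  have r: "restrict g (X - A) = restrict f (X - A) \<longleftrightarrow> sym_diff (supp X f) (supp X g) \<subseteq> A"
    if g: "g \<in> two_functions X" for A
  proof -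
    have "f x = 0 \<or> f x = 1" "g x = 0 \<or> g x = 1" if "x \<in> X" for x
      using f g that by (auto simp: two_functions_def dest!: PiE_mem)
    then have "x \<in> sym_diff (supp X f) (supp X g) \<longleftrightarrow> g x \<noteq> f x" if "x \<in> X" for x
      using that by (fastforce simp: supp_def)
    moreover have "sym_diff (supp X f) (supp X g) \<subseteq> X" by (auto simp: supp_def)
    moreover have "restrict g (X - A) = restrict f (X - A) \<longleftrightarrow> (\<forall>x\<in>X - A. g x = f x)"
      by (auto simp: fun_eq_iff)
    ultimately show ?thesis by blast
  qed
  have "g \<in> component (C_ballean X \<I>) f \<longleftrightarrow>
      g \<in> two_functions X \<and> (\<exists>A\<in>\<I>. sym_diff (supp X f) (supp X g) \<subseteq> A)"
    using r by (auto simp: component_def C_ballean_def)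
  also have "(\<exists>A\<in>\<I>. sym_diff (supp X f) (supp X g) \<subseteq> A) \<longleftrightarrow>
      sym_diff (supp X f) (supp X g) \<in> \<I>"
    using ideal_onD(2)[OF I] by blast
  finally show ?thesis .
qed

text \<open>Characteristic functions carry the classes of non-empty sets modulo \<I> to components
  of \<open>C_ballean X \<I>\<close>. The zero function is not the image of a non-empty set, but its
  component is still reached.\<close>

lemma dsc_hyperballean_star_ary_ordIso_C_ballean:
  assumes I: "ideal_on X \<I>"
  shows "dsc (hyperballean_star (ary_ballean X \<I>)) =o dsc (C_ballean X \<I>)"
  unfolding dsc_def components_def
proof (rule card_of_image_ordIso_image)
  let ?S = "hyperballean_star (ary_ballean X \<I>)"
  let ?h = "\<lambda>A. \<lambda>x\<in>X. if x \<in> A then 1 else (0::nat)"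
  have sA: "support (ary_ballean X \<I>) = X" by (simp add: ary_ballean_def)
  have sS: "support ?S = Pow X - {{}}"
    by (simp add: hyperballean_star_def subballean_def ary_ballean_def)
  have sC: "support (C_ballean X \<I>) = two_functions X" by (simp add: C_ballean_def)
  have h: "?h A \<in> two_functions X" for A by (auto simp: two_functions_def)
  have supp_h: "supp X (?h A) = A" if "A \<subseteq> X" for A
    using that by (auto simp: supp_def)
  \<comment> \<open>Derived from the hyperballean, because \<open>ary_ballean X \<I>\<close> itself
    violates the symmetry axiom.\<close>
  have bS: "is_ballean ?S"
    unfolding hyperballean_star_def
    by (rule is_ballean_subballean[OF is_ballean_hyperballean_ary_ballean[OF I]])
      (auto simp: hyperballean_def)
  note bC = is_ballean_C_ballean[OF I]
  show "?h ` support ?S \<subseteq> support (C_ballean X \<I>)"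
    unfolding sC using h by blast
  show "component ?S A = component ?S B \<longleftrightarrow>
      component (C_ballean X \<I>) (?h A) = component (C_ballean X \<I>) (?h B)"
    if A: "A \<in> support ?S" and B: "B \<in> support ?S" for A B
  proof -
    have AB: "A \<subseteq> X" "A \<noteq> {}" "B \<subseteq> X" "B \<noteq> {}" using A B unfolding sS by auto
    have "component ?S A = component ?S B \<longleftrightarrow> B \<in> component ?S A"
      by (rule component_eq_iff[OF bS A B])
    also have "\<dots> \<longleftrightarrow> sym_diff A B \<in> \<I>"
      using AB by (simp add: hyperballean_star_def component_subballean
          mem_component_hyperballean_ary[OF I] sA)
    also have "\<dots> \<longleftrightarrow> component (C_ballean X \<I>) (?h A) = component (C_ballean X \<I>) (?h B)"
      using h by (simp only: component_eq_iff[OF bC] sC mem_component_C_ballean[OF I]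
          supp_h AB simp_thms)
    finally show ?thesis .
  qed
  show "\<exists>A\<in>support ?S. component (C_ballean X \<I>) (?h A) = component (C_ballean X \<I>) f"
    if f: "f \<in> support (C_ballean X \<I>)" for f
  proof -
    \<comment> \<open>Inserting \<open>x\<close> makes the support non-empty and changes it by at
      most one point, hence within \<I>.\<close>
    obtain x where x: "x \<in> X" using ideal_onD(4)[OF I] by blast
    let ?A = "insert x (supp X f)"
    have A: "?A \<subseteq> X" using x by (auto simp: supp_def)
    have "sym_diff ?A (supp X f) \<in> \<I>"
    proof (rule ideal_onD(3)[OF I])
      show "finite (sym_diff ?A (supp X f))" by (rule finite_subset[of _ "{x}"]) auto
    qed (use A in auto)
    then have "component (C_ballean X \<I>) (?h ?A) = component (C_ballean X \<I>) f"
      using f h by (simp only: component_eq_iff[OF bC] sC mem_component_C_ballean[OF I]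
          supp_h[OF A] simp_thms)
    then show ?thesis using A unfolding sS by blast
  qed
qed

section \<open>Closeness criteria and identities for the numbers of components\<close>

theorem proposition4p1:
  fixes X :: "'a set" and \<I> :: "'a set set"
  assumes "ideal_on X \<I>"
  shows
    "(\<forall>Y Z. Y \<subseteq> X \<and> Y \<noteq> {} \<and> Z \<subseteq> X \<and> Z \<noteq> {} \<longrightarrow>
        (close_in (hyperballean (ary_ballean X \<I>)) Y Z \<longleftrightarrow> sym_diff Y Z \<in> \<I>)) \<and>
     (\<forall>f\<in>two_functions X. \<forall>g\<in>two_functions X.
        close_in (C_ballean X \<I>) f g \<longleftrightarrow> sym_diff (supp X f) (supp X g) \<in> \<I>) \<and>
     ((\<forall>A. A \<subseteq> X \<longrightarrow>
          component (hyperballean (point_ideal_ballean X \<I>)) A =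
          component (hyperballean (ary_ballean X \<I>)) A) \<and>
      dsc (hyperballean (point_ideal_ballean X \<I>)) =o dsc (hyperballean (ary_ballean X \<I>)) \<and>
      dsc (hyperballean_star (point_ideal_ballean X \<I>)) =o
        dsc (hyperballean_star (ary_ballean X \<I>)) \<and>
      dsc (hyperballean_star (ary_ballean X \<I>)) =o dsc (C_ballean X \<I>)) \<and>
     dsc (hyperballean (point_ideal_ballean X \<I>)) =o dsc (C_ballean X \<I>) +c cone"
proof (intro conjI allI ballI impI)
  note I = assms
  let ?P = "point_ideal_ballean X \<I>" and ?A = "ary_ballean X \<I>" and ?C = "C_ballean X \<I>"
  show "close_in (hyperballean ?A) Y Z \<longleftrightarrow> sym_diff Y Z \<in> \<I>"
    if "Y \<subseteq> X \<and> Y \<noteq> {} \<and> Z \<subseteq> X \<and> Z \<noteq> {}" for Y Z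
  proof -
    have "support (hyperballean ?A) = Pow X" by (simp add: hyperballean_def ary_ballean_def)
    then show ?thesis
      using that by (simp add: close_in_iff[OF is_ballean_hyperballean_ary_ballean[OF I]]
          mem_component_hyperballean_ary[OF I])
  qed
  show "close_in ?C f g \<longleftrightarrow> sym_diff (supp X f) (supp X g) \<in> \<I>"
    if "f \<in> two_functions X" "g \<in> two_functions X" for f g
  proof -
    have "support ?C = two_functions X" by (simp add: C_ballean_def)
    then show ?thesis
      using that by (simp add: close_in_iff[OF is_ballean_C_ballean[OF I]]
          mem_component_C_ballean[OF I])
  qed
  show "component (hyperballean ?P) A = component (hyperballean ?A) A" if "A \<subseteq> X" for A
    using component_hyperballean_point_ideal_eq_ary[OF I that] .
  show "dsc (hyperballean ?P) =o dsc (hyperballean ?A)"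
    unfolding dsc_def components_hyperballean_point_ideal_eq_ary[OF I] by (rule card_of_refl)
  show "dsc (hyperballean_star ?P) =o dsc (hyperballean_star ?A)"
    unfolding dsc_def components_hyperballean_star_point_ideal_eq_ary[OF I] by (rule card_of_refl)
  show star: "dsc (hyperballean_star ?A) =o dsc ?C"
    by (rule dsc_hyperballean_star_ary_ordIso_C_ballean[OF I])
  \<comment> \<open>Components of the starred ballean have only non-empty sets as members, so the
    component of \<open>{}\<close> is new and contributes exactly the summand
    \<open>cone\<close>.\<close>
  have "{{}} \<notin> components (hyperballean_star ?A)"
    unfolding components_hyperballean_star by blast
  then have "dsc (hyperballean ?P) =o dsc (hyperballean_star ?A) +c cone"
    unfolding dsc_def components_hyperballean_point_ideal_eq_ary[OF I]
      components_hyperballean_ary_eq_insert[OF I]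
    by (rule card_of_insert_csum_cone)
  also have "dsc (hyperballean_star ?A) +c cone =o dsc ?C +c cone"
    by (rule csum_cong1[OF star])
  finally show "dsc (hyperballean ?P) =o dsc ?C +c cone" .
qed

end
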